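(* Let $p>1$, $p'=\frac{p}{p-1}$, and $-1<\alpha<p-1$. A measurable function $h:(0,\infty)\to\mathbb{R}$ belongs to $\mathrm{Ces}_{p,\alpha}$ if and only if it admits a factorization $h=f\cdot g$ with $f\in L^p_\alpha$ and $g\in G_{p',\alpha(1-p')}$. Moreover, for every such $h$, $$\left(\frac1p\right)^{1/p}\left(\frac1{p'}\right)^{1/p'}\frac{p}{p-\alpha-1}\,N(h)\le\|h\|_{\mathrm{Ces}_{p,\alpha}}\le\frac{p}{p-\alpha-1}\,N(h),$$ where $$N(h)=\inf\|f\|_{L^p_\alpha}\|g\|_{G_{p',\alpha(1-p')}},$$ the infimum being taken over all factorizations $h=f\cdot g$ with $f\in L^p_\alpha$ and $g\in G_{p',\alpha(1-p')}$.
   Context: All functions are real-valued and Lebesgue measurable on $(0,\infty)$; equalities between functions are a.e. The spaces are those for power weights: $L^p_\alpha$ is the set of $f$ with $\|f\|_{L^p_\alpha}=\left(\int_0^\infty|f(x)|^p x^\alpha\,dx\right)^{1/p}<\infty$. $\mathrm{Ces}_{p,\alpha}$ is the set of $f$ with $\|f\|_{\mathrm{Ces}_{p,\alpha}}=\left(\int_0^\infty\left(\frac1x\int_0^x|f(t)|\,dt\right)^p x^\alpha\,dx\right)^{1/p}<\infty$. For $q>0$ and $\beta>-1$, $G_{q,\beta}$ is the set of $g$ with $\|g\|_{G_{q,\beta}}=\sup_{t>0}\left(\frac{1}{\int_0^t x^\beta\,dx}\int_0^t|g(x)|^q x^\beta\,dx\right)^{1/q}<\infty$. *)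

theory Defs
  imports "HOL-Analysis.Analysis"
begin

text \<open>
  Functions on $(0,\infty)$ are represented by total functions on the reals whose values outside
  \<^term>\<open>{0<..} :: real set\<close> are irrelevant. Norms take values in \<^typ>\<open>ennreal\<close>, so that a space is
  the set of measurable functions of finite norm.
\<close>

text \<open>The power \<open>a ^ r\<close> of an extended nonnegative real, meant for exponents \<open>r > 0\<close> only
  (the value at infinity is infinity, and the value at 0 is 0).\<close>

definition ennpowr :: "ennreal \<Rightarrow> real \<Rightarrow> ennreal" (infixr \<open>ennpowr\<close> 80) where
  "a ennpowr r = (if a = \<infinity> then \<infinity> else ennreal (enn2real a powr r))"

definition meas_pos :: "(real \<Rightarrow> real) set" where
  "meas_pos = borel_measurable (lebesgue_on {0<..})"

definition Lp_norm :: "real \<Rightarrow> real \<Rightarrow> (real \<Rightarrow> real) \<Rightarrow> ennreal" where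
  "Lp_norm p \<alpha> f =
     (\<integral>\<^sup>+x. ennreal (\<bar>f x\<bar> powr p * x powr \<alpha>) \<partial>lebesgue_on {0<..}) ennpowr (1 / p)"

definition Lp_space :: "real \<Rightarrow> real \<Rightarrow> (real \<Rightarrow> real) set" where
  "Lp_space p \<alpha> = {f \<in> meas_pos. Lp_norm p \<alpha> f < \<infinity>}"

definition Ces_norm :: "real \<Rightarrow> real \<Rightarrow> (real \<Rightarrow> real) \<Rightarrow> ennreal" where
  "Ces_norm p \<alpha> f =
     (\<integral>\<^sup>+x. (ennreal (1 / x) * (\<integral>\<^sup>+t. ennreal \<bar>f t\<bar> \<partial>lebesgue_on {0<..<x})) ennpowr p
            * ennreal (x powr \<alpha>) \<partial>lebesgue_on {0<..}) ennpowr (1 / p)"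

definition Ces_space :: "real \<Rightarrow> real \<Rightarrow> (real \<Rightarrow> real) set" where
  "Ces_space p \<alpha> = {f \<in> meas_pos. Ces_norm p \<alpha> f < \<infinity>}"

definition G_norm :: "real \<Rightarrow> real \<Rightarrow> (real \<Rightarrow> real) \<Rightarrow> ennreal" where
  "G_norm q \<beta> g =
     (SUP t\<in>{0<..}.
        ((\<integral>\<^sup>+x. ennreal (\<bar>g x\<bar> powr q * x powr \<beta>) \<partial>lebesgue_on {0<..<t})
         / (\<integral>\<^sup>+x. ennreal (x powr \<beta>) \<partial>lebesgue_on {0<..<t})) ennpowr (1 / q))"

definition G_space :: "real \<Rightarrow> real \<Rightarrow> (real \<Rightarrow> real) set" where
  "G_space q \<beta> = {g \<in> meas_pos. G_norm q \<beta> g < \<infinity>}"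

definition factorizations ::
  "real \<Rightarrow> real \<Rightarrow> real \<Rightarrow> real \<Rightarrow> (real \<Rightarrow> real) \<Rightarrow> ((real \<Rightarrow> real) \<times> (real \<Rightarrow> real)) set" where
  "factorizations p \<alpha> q \<beta> h =
     {(f, g). f \<in> Lp_space p \<alpha> \<and> g \<in> G_space q \<beta> \<and>
              (AE x in lebesgue_on {0<..}. h x = f x * g x)}"

definition factorization_norm ::
  "real \<Rightarrow> real \<Rightarrow> real \<Rightarrow> real \<Rightarrow> (real \<Rightarrow> real) \<Rightarrow> ennreal" where
  "factorization_norm p \<alpha> q \<beta> h =
     (INF (f, g)\<in>factorizations p \<alpha> q \<beta> h. Lp_norm p \<alpha> f * G_norm q \<beta> g)"

end

theory Submission
  imports Defs
begin

text \<open>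
  Write \<open>\<beta> = \<alpha> (1 - p')\<close> and \<open>\<kappa> = p - 1 - \<alpha> > 0\<close>; then \<open>\<beta> + 1 = \<kappa> / (p - 1)\<close>. Both estimates are one-variable
  arguments that rest on exchanging the order of integration over the triangle \<open>0 < t < x\<close>
  (\<open>Tonelli_triangle\<close>).

  For the upper estimate (\<open>Ces_norm_mult_le\<close>), Hoelder's inequality is applied to \<open>\<integral>\<^sub>0\<^sup>x |f g|\<close> after
  inserting the power \<open>t\<^sup>s t\<^sup>-\<^sup>s\<close>. The factor with \<open>g\<close> is then an integral of \<open>|g|\<close> to the power \<open>p'\<close>
  against \<open>t\<close> to the power \<open>\<beta> - \<gamma>\<close>. Membership of \<open>g\<close> in the space \<open>G\<close> says that the integrals of
  \<open>|g|\<close> to the power \<open>p'\<close> against \<open>x\<close> to the power \<open>\<beta>\<close> over initial intervals are at most a constant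
  times those of \<open>x\<close> to the power \<open>\<beta>\<close> alone, and such a domination survives multiplication by a
  decreasing weight (\<open>initial_integral_weight_mono\<close>). This leaves powers of \<open>x\<close> in the outer integral,
  and exchanging the integrals returns the norm of \<open>f\<close>. The choice \<open>\<gamma> = (\<beta> + 1) / p\<close> gives Hardy's
  constant \<open>p / \<kappa>\<close>.

  For the lower estimate (\<open>Ces_factorization\<close>), put \<open>I x = \<integral>\<^sub>0\<^sup>x |h|\<close> and let \<open>\<Psi> t\<close> be the integral of
  \<open>I x\<close> to the power \<open>p - 1\<close> against \<open>x\<close> to the power \<open>\<alpha> - p\<close> over \<open>x > t\<close>. Exchanging integrals turns
  the \<open>p\<close>-th power of the norm of \<open>h\<close> into \<open>\<integral> |h| \<Psi>\<close>. This dictates a factorization \<open>h = f g\<close> for which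
  \<open>f\<close> has exactly the norm of \<open>h\<close>: the integrand of the norm of \<open>f\<close> is \<open>|h| \<Psi>\<close>, and that of the norm
  of \<open>g\<close> is \<open>|h|\<close> times \<open>\<Psi>\<close> to the power \<open>-1 / (p - 1)\<close>. Since \<open>I\<close> increases, \<open>\<Psi> t\<close> is at least
  \<open>I t\<close> to the power \<open>p - 1\<close> times \<open>t\<close> to the power \<open>-\<kappa>\<close> divided by \<open>\<kappa>\<close>; as \<open>\<Psi>\<close> decreases, this bounds
  every average in the norm of \<open>g\<close> by a constant that depends on \<open>p\<close> and \<open>\<alpha>\<close> only. That constant is the reciprocal of the one
  in the theorem (\<open>lower_constant_eq\<close>), so this single factorization gives the lower estimate.
\<close>

section \<open>Powers of extended nonnegative reals and Hoelder's inequality\<close>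

lemma ennpowr_ennreal: "0 \<le> x \<Longrightarrow> ennreal x ennpowr r = ennreal (x powr r)"
  by (simp add: ennpowr_def)

lemma ennpowr_top [simp]: "top ennpowr r = top"
  by (simp add: ennpowr_def infinity_ennreal_def)

lemma ennpowr_0 [simp]: "0 ennpowr r = 0"
  by (simp add: ennpowr_def)

lemma ennpowr_one [simp]: "a ennpowr 1 = a"
  by (cases a) (simp_all add: ennpowr_ennreal)

lemma ennpowr_eq_top_iff [simp]: "a ennpowr r = top \<longleftrightarrow> a = top"
  by (cases a) (simp_all add: ennpowr_ennreal)

lemma ennpowr_less_top_iff [simp]: "a ennpowr r < top \<longleftrightarrow> a < top"
  by (simp flip: less_top)

lemma ennpowr_eq_0_iff [simp]: "a ennpowr r = 0 \<longleftrightarrow> a = 0"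
  by (cases a) (simp_all add: ennpowr_ennreal)

lemma ennpowr_mono: "a \<le> b \<Longrightarrow> 0 \<le> r \<Longrightarrow> a ennpowr r \<le> b ennpowr r"
  by (cases a; cases b) (auto simp: ennpowr_ennreal top_unique intro!: powr_mono2)

lemma ennpowr_ennpowr: "(a ennpowr r) ennpowr s = a ennpowr (r * s)"
  by (cases a) (simp_all add: ennpowr_ennreal powr_powr)

lemma ennpowr_mult: "(a * b) ennpowr r = a ennpowr r * b ennpowr r"
proof (cases a; cases b)
  fix x y assume "a = ennreal x" "b = ennreal y" "0 \<le> x" "0 \<le> y"
  then show ?thesis by (simp add: ennpowr_ennreal powr_mult flip: ennreal_mult)
qed (auto simp: ennpowr_ennreal ennreal_top_mult ennreal_mult_top)

lemma ennpowr_add: "0 < r \<Longrightarrow> 0 < s \<Longrightarrow> a ennpowr (r + s) = a ennpowr r * a ennpowr s"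
  by (cases a) (simp_all add: ennpowr_ennreal powr_add ennreal_mult)

lemma ennpowr_le_iff: 
  assumes "0 < r" shows "a ennpowr r \<le> b \<longleftrightarrow> a \<le> b ennpowr (1 / r)"
  using ennpowr_mono[of "a ennpowr r" b "1/r"] ennpowr_mono[of a "b ennpowr (1/r)" r] assms
  by (auto simp: ennpowr_ennpowr)

text \<open>
  This deduces finiteness of an integral of a lower power from that of a higher power when the
  measure is finite.
\<close>

lemma ennpowr_powr_le_1_plus:
  assumes "0 \<le> r" "r \<le> s" shows "a ennpowr r \<le> 1 + a ennpowr s"
proof (cases a)
  case (real x)
  have "x powr r \<le> 1 + x powr s"
  proof (cases "x \<le> 1")
    case True
    then have "x powr r \<le> 1" using real assms by (intro powr_le1) auto
    then show ?thesis using powr_ge_zero[of x s] by linarith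
  next
    case False
    then have "x powr r \<le> x powr s" using assms by (intro powr_mono) auto
    then show ?thesis by simp
  qed
  then have "ennreal (x powr r) \<le> ennreal (1 + x powr s)" by (rule ennreal_leI)
  then show ?thesis using real by (simp add: ennpowr_ennreal)
qed simp

lemma measurable_ennpowr [measurable]: "(\<lambda>a. a ennpowr r) \<in> borel_measurable borel"
  unfolding ennpowr_def by measurable

lemma ennreal_le_mult_of_divide_le:
  fixes a b c :: ennreal
  assumes "a / c \<le> b" "c \<noteq> 0" "c \<noteq> top"
  shows "a \<le> b * c"
proof -
  have "a = (a / c) * c"
    using assms by (simp add: ennreal_divide_times ennreal_divide_self less_top)
  also have "\<dots> \<le> b * c" by (intro mult_right_mono assms) simp
  finally show ?thesis .
qed

lemma Youngs_inequality_ennreal: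
  assumes "1 < p" "1 < q" "1 / p + 1 / q = 1"
  shows "a * b \<le> a ennpowr p * ennreal (1 / p) + b ennpowr q * ennreal (1 / q)"
proof (cases a; cases b)
  fix x y assume xy: "a = ennreal x" "b = ennreal y" "0 \<le> x" "0 \<le> y"
  have "x * y \<le> x powr p / p + y powr q / q"
    using Youngs_inequality[of p q x y] assms xy by simp
  then have "ennreal (x * y) \<le> ennreal (x powr p / p + y powr q / q)"
    by (rule ennreal_leI)
  also have "\<dots> = ennreal (x powr p / p) + ennreal (y powr q / q)"
    using assms by (intro ennreal_plus) auto
  finally show ?thesis
    using assms xy by (simp add: ennpowr_ennreal divide_inverse ennreal_mult)
qed (use assms in \<open>auto simp: ennpowr_ennreal ennreal_top_mult ennreal_mult_top\<close>)

text \<open>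
  Normalising both factors reduces the claim to the integral of Young's pointwise inequality. In the
  degenerate cases one of the factors vanishes almost everywhere, or the right-hand side is infinite.
\<close>

lemma Holder_inequality_nn_integral:
  fixes u v :: "'a \<Rightarrow> ennreal"
  assumes pq: "1 < p" "1 < q" "1 / p + 1 / q = 1"
    and [measurable]: "u \<in> borel_measurable M" "v \<in> borel_measurable M"
  shows "(\<integral>\<^sup>+x. u x * v x \<partial>M)
    \<le> (\<integral>\<^sup>+x. u x ennpowr p \<partial>M) ennpowr (1 / p) * (\<integral>\<^sup>+x. v x ennpowr q \<partial>M) ennpowr (1 / q)"
proof -
  define A where "A = (\<integral>\<^sup>+x. u x ennpowr p \<partial>M)"
  define B where "B = (\<integral>\<^sup>+x. v x ennpowr q \<partial>M)"
  consider "A = 0 \<or> B = 0" | "A \<noteq> 0" "B \<noteq> 0" "A = top \<or> B = top"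
    | "A \<noteq> 0" "B \<noteq> 0" "A \<noteq> top" "B \<noteq> top" by blast
  then show ?thesis
  proof cases
    case 1
    then have "(AE x in M. u x ennpowr p = 0) \<or> (AE x in M. v x ennpowr q = 0)"
      unfolding A_def B_def by (subst (asm) (1 2) nn_integral_0_iff_AE) auto
    then have "AE x in M. u x * v x = 0" by auto
    then have "(\<integral>\<^sup>+x. u x * v x \<partial>M) = 0"
      by (subst nn_integral_0_iff_AE) auto
    then show ?thesis by simp
  next
    case 2
    then have "A ennpowr (1 / p) * B ennpowr (1 / q) = top"
      by (auto simp: ennreal_mult_eq_top_iff)
    then show ?thesis unfolding A_def B_def by simp
  next
    case 3
    define a where "a = A ennpowr (1 / p)"
    define b where "b = B ennpowr (1 / q)"
    have ab: "a \<noteq> 0" "a \<noteq> top" "b \<noteq> 0" "b \<noteq> top" 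
      using 3 by (auto simp: a_def b_def)
    have aa: "a * inverse a = 1" "b * inverse b = 1"
      using ab by (cases a; cases b; auto simp: inverse_ennreal simp flip: ennreal_mult)+
    have "(a * inverse a) ennpowr p = A * inverse a ennpowr p"
      "(b * inverse b) ennpowr q = B * inverse b ennpowr q"
      using pq by (simp_all add: ennpowr_mult a_def b_def ennpowr_ennpowr)
    then have inv: "inverse a ennpowr p * A = 1" "inverse b ennpowr q * B = 1"
      using ennpowr_ennreal[of 1] by (simp_all add: aa mult.commute)
    have "(\<integral>\<^sup>+x. u x * v x \<partial>M) = (\<integral>\<^sup>+x. a * b * ((inverse a * u x) * (inverse b * v x)) \<partial>M)"
    proof (rule nn_integral_cong)
      fix x
      have "u x * v x = (a * inverse a) * (b * inverse b) * (u x * v x)" by (simp add: aa)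
      then show "u x * v x = a * b * ((inverse a * u x) * (inverse b * v x))"
        by (simp only: mult_ac)
    qed
    also have "\<dots> = a * b * (\<integral>\<^sup>+x. (inverse a * u x) * (inverse b * v x) \<partial>M)"
      by (rule nn_integral_cmult) measurable
    also have "(\<integral>\<^sup>+x. (inverse a * u x) * (inverse b * v x) \<partial>M)
      \<le> (\<integral>\<^sup>+x. (inverse a ennpowr p * u x ennpowr p) * ennreal (1 / p)
           + (inverse b ennpowr q * v x ennpowr q) * ennreal (1 / q) \<partial>M)"
      unfolding ennpowr_mult[symmetric]
      by (intro nn_integral_mono Youngs_inequality_ennreal pq)
    also have "\<dots> = inverse a ennpowr p * A * ennreal (1 / p) + inverse b ennpowr q * B * ennreal (1 / q)"
      by (subst nn_integral_add) (auto simp: nn_integral_multc nn_integral_cmult A_def B_def)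
    also have "\<dots> = 1"
      using pq by (simp add: inv flip: ennreal_plus)
    finally show ?thesis
      by (simp add: a_def b_def A_def B_def mult_left_mono)
  qed
qed

section \<open>Initial and final integrals on the half-line\<close>

abbreviation (input) ray :: "real measure" where "ray \<equiv> lebesgue_on {0<..}"

lemma measurable_ident_ray: "(\<lambda>x. x) \<in> borel_measurable ray"
  by (intro measurable_restrict_space1 measurable_completion) simp

lemma borel_measurable_imp_ray: "f \<in> borel_measurable borel \<Longrightarrow> f \<in> borel_measurable ray"
  using measurable_compose[OF measurable_ident_ray] .

lemma measurable_powr_ray [measurable]: "(\<lambda>x. x powr a) \<in> borel_measurable ray"
  by (intro borel_measurable_imp_ray) simp

lemma borel_measurable_indicator_ray [measurable]:
  "(indicator {..<x} :: real \<Rightarrow> ennreal) \<in> borel_measurable ray"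
  "(indicator {x<..} :: real \<Rightarrow> ennreal) \<in> borel_measurable ray"
  by (intro borel_measurable_imp_ray; simp)+

lemma measurable_restrict_initial:
  "u \<in> borel_measurable ray \<Longrightarrow> u \<in> borel_measurable (lebesgue_on {0<..<x})"
  by (rule measurable_restrict_mono) auto

lemma measurable_restrict_final:
  "u \<in> borel_measurable ray \<Longrightarrow> 0 \<le> t \<Longrightarrow> u \<in> borel_measurable (lebesgue_on {t<..})"
  by (rule measurable_restrict_mono) auto

text \<open>
  Tonelli's theorem takes place in the product of two copies of the half-line with Lebesgue measure,
  for which measurability of the triangle comes from that of the two projections into the Borel line.
\<close>

lemma measurable_triangle: "Measurable.pred (ray \<Otimes>\<^sub>M ray) (\<lambda>z. fst z < snd z)"
  "Measurable.pred (ray \<Otimes>\<^sub>M ray) (\<lambda>z. snd z < fst z)"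
proof -
  have [measurable]: "fst \<in> borel_measurable (ray \<Otimes>\<^sub>M ray)" "snd \<in> borel_measurable (ray \<Otimes>\<^sub>M ray)"
    using measurable_compose[OF measurable_fst measurable_ident_ray]
      measurable_compose[OF measurable_snd measurable_ident_ray] by auto
  show "Measurable.pred (ray \<Otimes>\<^sub>M ray) (\<lambda>z. fst z < snd z)"
    "Measurable.pred (ray \<Otimes>\<^sub>M ray) (\<lambda>z. snd z < fst z)"
    by measurable
qed

lemma sigma_finite_ray: "sigma_finite_measure ray"
proof (rule sigma_finite_measure_restrict_space)
  show "sigma_finite_measure (lebesgue :: real measure)"
  proof
    show "\<exists>A. countable A \<and> A \<subseteq> sets lebesgue \<and> \<Union> A = space (lebesgue :: real measure)
        \<and> (\<forall>a\<in>A. emeasure lebesgue a \<noteq> \<infinity>)"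
    proof (intro exI[of _ "range (\<lambda>n. {- real n..real n})"] conjI)
      have "x \<in> (\<Union>n. {- real n..real n})" for x :: real
      proof -
        obtain n where "\<bar>x\<bar> \<le> real n" using real_arch_simple by blast
        then show ?thesis by (intro UN_I[of n]) auto
      qed
      then show "(\<Union>n. {- real n..real n}) = space (lebesgue :: real measure)"
        by auto
    qed auto
  qed
qed auto

lemma nn_integral_initial:
  "0 \<le> x \<Longrightarrow> (\<integral>\<^sup>+t. u t \<partial>lebesgue_on {0<..<x}) = (\<integral>\<^sup>+t. u t * indicator {..<x} t \<partial>ray)"
  by (auto simp: nn_integral_restrict_space indicator_def intro!: nn_integral_cong)

lemma nn_integral_final:
  "0 < t \<Longrightarrow> (\<integral>\<^sup>+x. k x \<partial>lebesgue_on {t<..}) = (\<integral>\<^sup>+x. k x * indicator {t<..} x \<partial>ray)"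
  by (auto simp: nn_integral_restrict_space indicator_def intro!: nn_integral_cong)

lemma measurable_initial_integral:
  assumes [measurable]: "u \<in> borel_measurable ray"
  shows "(\<lambda>x. \<integral>\<^sup>+t. u t \<partial>lebesgue_on {0<..<x}) \<in> borel_measurable ray"
proof -
  interpret sigma_finite_measure ray by (rule sigma_finite_ray)
  note [measurable] = measurable_triangle
  have "(\<lambda>x. \<integral>\<^sup>+t. u t * (if t < x then 1 else 0) \<partial>ray) \<in> borel_measurable ray"
    by measurable
  then show ?thesis
    by (rule measurable_cong[THEN iffD1, rotated])
      (simp add: nn_integral_initial indicator_def of_bool_def)
qed

lemma measurable_final_integral:
  assumes [measurable]: "k \<in> borel_measurable ray"
  shows "(\<lambda>t. \<integral>\<^sup>+x. k x \<partial>lebesgue_on {t<..}) \<in> borel_measurable ray"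
proof -
  interpret sigma_finite_measure ray by (rule sigma_finite_ray)
  note [measurable] = measurable_triangle
  have "(\<lambda>t. \<integral>\<^sup>+x. k x * (if t < x then 1 else 0) \<partial>ray) \<in> borel_measurable ray"
    by measurable
  then show ?thesis
    by (rule measurable_cong[THEN iffD1, rotated])
      (simp add: nn_integral_final indicator_def of_bool_def)
qed

lemma Tonelli_triangle:
  assumes [measurable]: "u \<in> borel_measurable ray" "k \<in> borel_measurable ray"
  shows "(\<integral>\<^sup>+x. k x * (\<integral>\<^sup>+t. u t \<partial>lebesgue_on {0<..<x}) \<partial>ray)
    = (\<integral>\<^sup>+t. u t * (\<integral>\<^sup>+x. k x \<partial>lebesgue_on {t<..}) \<partial>ray)"
proof -
  interpret R: sigma_finite_measure ray by (rule sigma_finite_ray)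
  interpret pair_sigma_finite ray ray ..
  note [measurable] = measurable_triangle
  have "(\<integral>\<^sup>+x. k x * (\<integral>\<^sup>+t. u t \<partial>lebesgue_on {0<..<x}) \<partial>ray)
    = (\<integral>\<^sup>+x. (\<integral>\<^sup>+t. k x * u t * (if t < x then 1 else 0) \<partial>ray) \<partial>ray)"
  proof (rule nn_integral_cong)
    fix x assume "x \<in> space ray"
    then have "k x * (\<integral>\<^sup>+t. u t \<partial>lebesgue_on {0<..<x})
      = (\<integral>\<^sup>+t. k x * (u t * indicator {..<x} t) \<partial>ray)"
      by (subst nn_integral_cmult) (auto simp: nn_integral_initial)
    then show "k x * (\<integral>\<^sup>+t. u t \<partial>lebesgue_on {0<..<x})
      = (\<integral>\<^sup>+t. k x * u t * (if t < x then 1 else 0) \<partial>ray)"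
      by (simp add: indicator_def of_bool_def mult_ac)
  qed
  also have "\<dots> = (\<integral>\<^sup>+t. (\<integral>\<^sup>+x. k x * u t * (if t < x then 1 else 0) \<partial>ray) \<partial>ray)"
    by (rule Fubini') measurable
  also have "\<dots> = (\<integral>\<^sup>+t. u t * (\<integral>\<^sup>+x. k x \<partial>lebesgue_on {t<..}) \<partial>ray)"
  proof (rule nn_integral_cong)
    fix t assume "t \<in> space ray"
    then have "u t * (\<integral>\<^sup>+x. k x \<partial>lebesgue_on {t<..})
      = (\<integral>\<^sup>+x. u t * (k x * indicator {t<..} x) \<partial>ray)"
      by (subst nn_integral_cmult) (auto simp: nn_integral_final)
    then show "(\<integral>\<^sup>+x. k x * u t * (if t < x then 1 else 0) \<partial>ray)
      = u t * (\<integral>\<^sup>+x. k x \<partial>lebesgue_on {t<..})"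
      by (simp add: indicator_def of_bool_def mult_ac)
  qed
  finally show ?thesis .
qed

lemma nn_integral_powr_initial:
  assumes "-1 < a" "0 \<le> x"
  shows "(\<integral>\<^sup>+t. ennreal (t powr a) \<partial>lebesgue_on {0<..<x}) = ennreal (x powr (a + 1) / (a + 1))"
proof -
  have "(\<integral>\<^sup>+t. ennreal (t powr a) \<partial>lebesgue_on {0<..<x})
    = (\<integral>\<^sup>+t. ennreal (t powr a) * indicator {0<..<x} t \<partial>lborel)"
    by (subst nn_integral_restrict_space) (auto intro!: nn_integral_completion)
  also have "\<dots> = (\<integral>\<^sup>+t. ennreal (t powr a) * indicator {0..x} t \<partial>lborel)"
  proof (rule nn_integral_cong_AE)
    show "AE t in lborel. ennreal (t powr a) * indicator {0<..<x} t
      = ennreal (t powr a) * indicator {0..x} t"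
      using AE_lborel_singleton[of 0] AE_lborel_singleton[of x]
      by eventually_elim (auto simp: indicator_def)
  qed
  also have "\<dots> = ennreal (x powr (a + 1) / (a + 1))"
    by (intro nn_integral_has_integral_lebesgue' has_integral_powr_from_0 assms) auto
  finally show ?thesis .
qed

lemma nn_integral_powr_final:
  assumes "0 < a" "0 < t"
  shows "(\<integral>\<^sup>+x. ennreal (x powr (-1 - a)) \<partial>lebesgue_on {t<..}) = ennreal (t powr (-a) / a)"
proof -
  have "(\<integral>\<^sup>+x. ennreal (x powr (-1 - a)) \<partial>lebesgue_on {t<..})
    = (\<integral>\<^sup>+x. ennreal (x powr (-1 - a)) * indicator {t<..} x \<partial>lborel)"
    by (subst nn_integral_restrict_space) (auto intro!: nn_integral_completion)
  also have "\<dots> = (\<integral>\<^sup>+x. ennreal (x powr (-1 - a)) * indicator {t..} x \<partial>lborel)"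
  proof (rule nn_integral_cong_AE)
    show "AE x in lborel. ennreal (x powr (-1 - a)) * indicator {t<..} x
      = ennreal (x powr (-1 - a)) * indicator {t..} x"
      using AE_lborel_singleton[of t]
      by eventually_elim (auto simp: indicator_def)
  qed
  also have "\<dots> = ennreal (t powr (-a) / a)"
    using has_integral_powr_to_inf[of "-1 - a" t] assms
    by (intro nn_integral_has_integral_lebesgue') (auto simp: divide_simps)
  finally show ?thesis .
qed

lemma initial_integral_mono:
  fixes x y :: real
  shows "x \<le> y \<Longrightarrow> (\<integral>\<^sup>+t. u t \<partial>lebesgue_on {0<..<x}) \<le> (\<integral>\<^sup>+t. u t \<partial>lebesgue_on {0<..<y})"
  by (subst (1 2) nn_integral_restrict_space)
    (auto simp: indicator_def intro!: nn_integral_mono)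

lemma final_integral_antimono:
  fixes s t :: real
  shows "t \<le> s \<Longrightarrow> (\<integral>\<^sup>+x. k x \<partial>lebesgue_on {s<..}) \<le> (\<integral>\<^sup>+x. k x \<partial>lebesgue_on {t<..})"
  by (subst (1 2) nn_integral_restrict_space)
    (auto simp: indicator_def intro!: nn_integral_mono)

lemma initial_integral_cutoff:
  fixes s x :: real
  shows "(\<integral>\<^sup>+t. u t * indicator {..<x} t \<partial>lebesgue_on {0<..<s})
    = (\<integral>\<^sup>+t. u t \<partial>lebesgue_on {0<..<min s x})"
  by (subst (1 2) nn_integral_restrict_space)
    (auto simp: indicator_def intro!: nn_integral_cong)

text \<open>
  The weight \<open>\<lambda>t. \<integral>\<^sub>t\<^sup>\<infinity> k\<close> is a superposition of indicators of initial intervals, so domination of all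
  initial integrals of \<open>u\<close> by those of \<open>v\<close> carries over to the weighted integrals. Cutting the
  functions off at \<open>x\<close> preserves the domination.
\<close>

lemma initial_integral_weight_mono:
  assumes [measurable]: "u \<in> borel_measurable ray" "v \<in> borel_measurable ray"
    "k \<in> borel_measurable ray"
    and le: "\<And>s. 0 < s \<Longrightarrow> (\<integral>\<^sup>+t. u t \<partial>lebesgue_on {0<..<s}) \<le> (\<integral>\<^sup>+t. v t \<partial>lebesgue_on {0<..<s})"
    and "0 < x"
  shows "(\<integral>\<^sup>+t. u t * (\<integral>\<^sup>+y. k y \<partial>lebesgue_on {t<..}) \<partial>lebesgue_on {0<..<x})
    \<le> (\<integral>\<^sup>+t. v t * (\<integral>\<^sup>+y. k y \<partial>lebesgue_on {t<..}) \<partial>lebesgue_on {0<..<x})"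
proof -
  have swap: "(\<integral>\<^sup>+t. w t * (\<integral>\<^sup>+y. k y \<partial>lebesgue_on {t<..}) \<partial>lebesgue_on {0<..<x})
    = (\<integral>\<^sup>+y. k y * (\<integral>\<^sup>+t. w t \<partial>lebesgue_on {0<..<min y x}) \<partial>ray)"
    if [measurable]: "w \<in> borel_measurable ray" for w
    using Tonelli_triangle[of "\<lambda>t. w t * indicator {..<x} t" k] \<open>0 < x\<close>
    by (simp add: nn_integral_initial initial_integral_cutoff mult_ac)
  show ?thesis
    unfolding swap[OF assms(1)] swap[OF assms(2)]
    using \<open>0 < x\<close> by (intro nn_integral_mono mult_left_mono le) auto
qed

text \<open>
  Replacing the increasing initial integral by its value at the left end of the range leaves a pure
  power. With exponent \<open>p\<close> this shows that functions of finite Cesaro norm are integrable on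
  the intervals \<open>(0, t)\<close>; with exponent \<open>p - 1\<close> it bounds the function \<open>\<Psi>\<close> of the factorization from below.
\<close>

lemma initial_integral_tail_bound:
  fixes u :: "real \<Rightarrow> ennreal"
  assumes r: "0 \<le> r" and \<kappa>: "0 < \<kappa>" and t: "0 < t"
  defines "I \<equiv> \<lambda>x. \<integral>\<^sup>+s. u s \<partial>lebesgue_on {0<..<x}"
  shows "I t ennpowr r * ennreal (t powr (- \<kappa>) / \<kappa>)
    \<le> (\<integral>\<^sup>+x. I x ennpowr r * ennreal (x powr (- 1 - \<kappa>)) \<partial>lebesgue_on {t<..})"
proof -
  have "I t ennpowr r * ennreal (t powr (- \<kappa>) / \<kappa>)
    = (\<integral>\<^sup>+x. I t ennpowr r * ennreal (x powr (- 1 - \<kappa>)) \<partial>lebesgue_on {t<..})"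
    using nn_integral_powr_final[OF \<kappa> t]
    by (subst nn_integral_cmult) (auto intro!: measurable_restrict_space1 measurable_completion)
  also have "\<dots> \<le> (\<integral>\<^sup>+x. I x ennpowr r * ennreal (x powr (- 1 - \<kappa>)) \<partial>lebesgue_on {t<..})"
    unfolding I_def
    by (intro nn_integral_mono mult_right_mono ennpowr_mono initial_integral_mono r) auto
  finally show ?thesis .
qed

lemma AE_restrict_initial:
  assumes "AE x in ray. P x" shows "AE t in lebesgue_on {0<..<x}. P t"
proof -
  have "AE t in lebesgue. 0 < t \<longrightarrow> P t"
    using assms by (simp add: AE_restrict_space_iff)
  then have "AE t in lebesgue. t \<in> {0<..<x} \<longrightarrow> P t"
    by (rule eventually_mono) simp
  then show ?thesis by (simp add: AE_restrict_space_iff)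
qed

lemma AE_ray_eq_0I:
  fixes h :: "real \<Rightarrow> real"
  assumes [measurable]: "h \<in> borel_measurable ray"
    and 0: "\<And>x. t \<le> x \<Longrightarrow> (\<integral>\<^sup>+s. ennreal \<bar>h s\<bar> \<partial>lebesgue_on {0<..<x}) = 0"
  shows "AE x in ray. h x = 0"
proof -
  have "AE s in ray. s < real n \<longrightarrow> h s = 0" if "t \<le> real n" for n
  proof -
    have "(\<integral>\<^sup>+s. ennreal \<bar>h s\<bar> * indicator {..<real n} s \<partial>ray) = 0"
      using 0[OF that] by (simp add: nn_integral_initial)
    then have "AE s in ray. ennreal \<bar>h s\<bar> * indicator {..<real n} s = 0"
      by (subst (asm) nn_integral_0_iff_AE) auto
    then show ?thesis by eventually_elim (auto simp: indicator_def)
  qed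
  then have "AE s in ray. \<forall>n. t \<le> real n \<longrightarrow> s < real n \<longrightarrow> h s = 0"
    by (auto simp: AE_all_countable)
  then show ?thesis
  proof eventually_elim
    case (elim s)
    obtain n where "max t s < real n" using reals_Archimedean2 by blast
    then show ?case using spec[OF elim, of n] by auto
  qed
qed

section \<open>Hardy's inequality with a factor from the space G\<close>

lemma G_norm_average_bound:
  assumes "0 < q" "-1 < \<beta>" "0 < t"
  shows "(\<integral>\<^sup>+x. ennreal (\<bar>g x\<bar> powr q * x powr \<beta>) \<partial>lebesgue_on {0<..<t})
    \<le> G_norm q \<beta> g ennpowr q * (\<integral>\<^sup>+x. ennreal (x powr \<beta>) \<partial>lebesgue_on {0<..<t})"
    (is "?N \<le> _ * ?D")
proof (rule ennreal_le_mult_of_divide_le)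
  have "(?N / ?D) ennpowr (1 / q) \<le> G_norm q \<beta> g"
    unfolding G_norm_def using assms by (intro SUP_upper) auto
  then show "?N / ?D \<le> G_norm q \<beta> g ennpowr q"
    using assms by (subst (asm) ennpowr_le_iff) auto
qed (use assms in \<open>auto simp: nn_integral_powr_initial ennreal_eq_0_iff not_le\<close>)

text \<open>
  The decreasing weight of \<open>t\<close> to the power \<open>-\<gamma>\<close> is the tail integral of \<open>\<gamma>\<close> times \<open>s\<close> to the power
  \<open>-1 - \<gamma>\<close>, so the domination expressed by the norm of \<open>g\<close> can be multiplied by it.
\<close>

lemma G_norm_weighted_bound:
  assumes q: "0 < q" and \<gamma>: "0 < \<gamma>" "\<gamma> < \<beta> + 1" and "0 < x"
    and g: "g \<in> meas_pos"
  shows "(\<integral>\<^sup>+t. ennreal (\<bar>g t\<bar> powr q * t powr (\<beta> - \<gamma>)) \<partial>lebesgue_on {0<..<x})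
    \<le> G_norm q \<beta> g ennpowr q * ennreal (x powr (\<beta> + 1 - \<gamma>) / (\<beta> + 1 - \<gamma>))"
proof -
  have [measurable]: "g \<in> borel_measurable ray" using g by (simp add: meas_pos_def)
  let ?K = "G_norm q \<beta> g ennpowr q"
  let ?k = "\<lambda>s. ennreal (\<gamma> * s powr (- 1 - \<gamma>))"
  have k: "(\<integral>\<^sup>+s. ?k s \<partial>lebesgue_on {t<..}) = ennreal (t powr (- \<gamma>))" if "0 < t" for t
  proof -
    have "(\<integral>\<^sup>+s. ?k s \<partial>lebesgue_on {t<..})
      = (\<integral>\<^sup>+s. ennreal \<gamma> * ennreal (s powr (- 1 - \<gamma>)) \<partial>lebesgue_on {t<..})"
      using \<gamma> by (simp add: ennreal_mult)
    also have "\<dots> = ennreal \<gamma> * (\<integral>\<^sup>+s. ennreal (s powr (- 1 - \<gamma>)) \<partial>lebesgue_on {t<..})"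
      by (intro nn_integral_cmult measurable_restrict_space1 measurable_completion) simp
    also have "\<dots> = ennreal (t powr (- \<gamma>))"
      using \<gamma> that nn_integral_powr_final[of \<gamma> t] by (simp flip: ennreal_mult)
    finally show ?thesis .
  qed
  have "(\<integral>\<^sup>+t. ennreal (\<bar>g t\<bar> powr q * t powr (\<beta> - \<gamma>)) \<partial>lebesgue_on {0<..<x})
    = (\<integral>\<^sup>+t. ennreal (\<bar>g t\<bar> powr q * t powr \<beta>) * (\<integral>\<^sup>+s. ?k s \<partial>lebesgue_on {t<..}) \<partial>lebesgue_on {0<..<x})"
  proof (intro nn_integral_cong)
    fix t assume "t \<in> space (lebesgue_on {0<..<x})"
    then have "0 < t" by simp
    then show "ennreal (\<bar>g t\<bar> powr q * t powr (\<beta> - \<gamma>))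
      = ennreal (\<bar>g t\<bar> powr q * t powr \<beta>) * (\<integral>\<^sup>+s. ?k s \<partial>lebesgue_on {t<..})"
      by (subst k) (simp_all add: powr_diff powr_minus divide_inverse mult.assoc flip: ennreal_mult)
  qed
  also have "\<dots> \<le> (\<integral>\<^sup>+t. (?K * ennreal (t powr \<beta>)) * (\<integral>\<^sup>+s. ?k s \<partial>lebesgue_on {t<..}) \<partial>lebesgue_on {0<..<x})"
  proof (intro initial_integral_weight_mono)
    fix s :: real assume "0 < s"
    then show "(\<integral>\<^sup>+t. ennreal (\<bar>g t\<bar> powr q * t powr \<beta>) \<partial>lebesgue_on {0<..<s})
      \<le> (\<integral>\<^sup>+t. ?K * ennreal (t powr \<beta>) \<partial>lebesgue_on {0<..<s})"
      using G_norm_average_bound[of q \<beta> s g] q \<gamma>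
      by (subst nn_integral_cmult) (auto intro!: measurable_restrict_space1 measurable_completion)
  qed (use \<open>0 < x\<close> in measurable)
  also have "\<dots> = (\<integral>\<^sup>+t. ?K * ennreal (t powr (\<beta> - \<gamma>)) \<partial>lebesgue_on {0<..<x})"
  proof (intro nn_integral_cong)
    fix t assume "t \<in> space (lebesgue_on {0<..<x})"
    then have "0 < t" by simp
    then show "?K * ennreal (t powr \<beta>) * (\<integral>\<^sup>+s. ?k s \<partial>lebesgue_on {t<..})
      = ?K * ennreal (t powr (\<beta> - \<gamma>))"
      by (subst k) (simp_all add: powr_diff powr_minus divide_inverse mult.assoc flip: ennreal_mult)
  qed
  also have "\<dots> = ?K * ennreal (x powr (\<beta> + 1 - \<gamma>) / (\<beta> + 1 - \<gamma>))"
    using nn_integral_powr_initial[of "\<beta> - \<gamma>" x] \<gamma> \<open>0 < x\<close>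
    by (subst nn_integral_cmult)
      (auto simp: algebra_simps intro!: measurable_restrict_space1 measurable_completion)
  finally show ?thesis .
qed

text \<open>
  Hardy's inequality is the case \<open>g = 1\<close>, and its constant is recovered. Hoelder's inequality with the
  auxiliary weight \<open>t\<^sup>s\<close> costs nothing in the constant because the exponent \<open>\<delta>\<close> that it leaves appears
  twice: as the exponent of the bound for \<open>g\<close> and as the exponent gained in the outer integral.
  Together they contribute \<open>1 / \<delta>\<close> to the power \<open>(p - 1) + 1\<close>.
\<close>

lemma Ces_norm_mult_le:
  assumes p: "1 < p" and q: "q = p / (p - 1)" and \<alpha>: "\<alpha> < p - 1"
    and f: "f \<in> meas_pos" and g: "g \<in> meas_pos"
  shows "Ces_norm p \<alpha> (\<lambda>x. f x * g x)
    \<le> ennreal (p / (p - \<alpha> - 1)) * (Lp_norm p \<alpha> f * G_norm q (\<alpha> * (1 - q)) g)"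
proof -
  define \<delta> where "\<delta> = (p - \<alpha> - 1) / p"
  define \<beta> where "\<beta> = \<alpha> * (1 - q)"
  \<comment> \<open>\<open>\<gamma>\<close> maximises \<open>\<gamma> (\<beta> + 1 - \<gamma>)\<^sup>p\<^sup>-\<^sup>1\<close>, the reciprocal of the \<open>p\<close>-th power of the constant
    up to a factor \<open>p - 1\<close>; at this point \<open>\<beta> + 1 - \<gamma> = (p - 1) \<gamma> = \<delta>\<close>.\<close>
  define \<gamma> where "\<gamma> = \<delta> / (p - 1)"
  define s where "s = (\<alpha> + \<delta>) / p"
  define G where "G = G_norm q (\<alpha> * (1 - q)) g"
  have [measurable]: "f \<in> borel_measurable ray" "g \<in> borel_measurable ray"
    using f g by (simp_all add: meas_pos_def)
  have pos: "0 < \<delta>" "0 < \<gamma>" "1 < q"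
    using p \<alpha> by (auto simp: \<delta>_def \<gamma>_def q field_simps)
  have conj: "1 / p + 1 / q = 1" "p / q = p - 1"
    using p by (auto simp: q field_simps)
  have \<beta>1: "\<beta> + 1 - \<gamma> = \<delta>"
    using p by (simp add: \<beta>_def \<gamma>_def \<delta>_def q divide_simps) algebra
  have sq: "- (s * q) = \<beta> - \<gamma>"
    using p by (simp add: \<beta>_def \<gamma>_def s_def q divide_simps)
  have sp: "s * p = \<alpha> + \<delta>" using p by (simp add: s_def)
  let ?A = "\<lambda>x. \<integral>\<^sup>+t. ennreal (\<bar>f t\<bar> powr p * t powr (\<alpha> + \<delta>)) \<partial>lebesgue_on {0<..<x}"
  let ?C = "G ennpowr p * ennreal ((1 / \<delta>) powr (p - 1))"
  have Holder: "(\<integral>\<^sup>+t. ennreal \<bar>f t * g t\<bar> \<partial>lebesgue_on {0<..<x})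
      \<le> ?A x ennpowr (1 / p) * (G ennpowr q * ennreal (x powr \<delta> / \<delta>)) ennpowr (1 / q)"
    if "0 < x" for x
  proof -
    have "(\<integral>\<^sup>+t. ennreal \<bar>f t * g t\<bar> \<partial>lebesgue_on {0<..<x})
      = (\<integral>\<^sup>+t. ennreal (\<bar>f t\<bar> * t powr s) * ennreal (\<bar>g t\<bar> * t powr (- s)) \<partial>lebesgue_on {0<..<x})"
      by (intro nn_integral_cong) (auto simp: abs_mult powr_minus field_simps simp flip: ennreal_mult)
    also have "\<dots> \<le> (\<integral>\<^sup>+t. ennreal (\<bar>f t\<bar> * t powr s) ennpowr p \<partial>lebesgue_on {0<..<x}) ennpowr (1 / p)
      * (\<integral>\<^sup>+t. ennreal (\<bar>g t\<bar> * t powr (- s)) ennpowr q \<partial>lebesgue_on {0<..<x}) ennpowr (1 / q)"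
      by (rule Holder_inequality_nn_integral[OF p \<open>1 < q\<close> conj(1)];
          rule measurable_restrict_initial) measurable
    also have "(\<lambda>t. ennreal (\<bar>f t\<bar> * t powr s) ennpowr p) = (\<lambda>t. ennreal (\<bar>f t\<bar> powr p * t powr (\<alpha> + \<delta>)))"
      by (simp add: ennpowr_ennreal powr_mult powr_powr sp)
    also have "(\<lambda>t. ennreal (\<bar>g t\<bar> * t powr (- s)) ennpowr q) = (\<lambda>t. ennreal (\<bar>g t\<bar> powr q * t powr (\<beta> - \<gamma>)))"
      by (simp add: ennpowr_ennreal powr_mult powr_powr flip: sq)
    also have "(\<integral>\<^sup>+t. ennreal (\<bar>g t\<bar> powr q * t powr (\<beta> - \<gamma>)) \<partial>lebesgue_on {0<..<x})
      \<le> G ennpowr q * ennreal (x powr \<delta> / \<delta>)"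
      using G_norm_weighted_bound[of q \<gamma> \<beta> x g] pos that g \<beta>1
      by (simp add: \<beta>_def G_def)
    finally show ?thesis using pos by (simp add: ennpowr_mono mult_left_mono)
  qed
  have "(ennreal (1 / x) * (\<integral>\<^sup>+t. ennreal \<bar>f t * g t\<bar> \<partial>lebesgue_on {0<..<x})) ennpowr p * ennreal (x powr \<alpha>)
      \<le> ?C * (ennreal (x powr (-1 - \<delta>)) * ?A x)" if "0 < x" for x
  proof -
    have "(ennreal (1 / x) * (\<integral>\<^sup>+t. ennreal \<bar>f t * g t\<bar> \<partial>lebesgue_on {0<..<x})) ennpowr p
      \<le> (ennreal (1 / x) * (?A x ennpowr (1 / p) * (G ennpowr q * ennreal (x powr \<delta> / \<delta>)) ennpowr (1 / q))) ennpowr p"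
      using p by (intro ennpowr_mono mult_left_mono Holder that) auto
    also have "\<dots> = ennreal ((1 / x) powr p) * ?A x * (G ennpowr p * ennreal ((x powr \<delta> / \<delta>) powr (p - 1)))"
      using p pos that conj(2)
      by (simp add: ennpowr_mult ennpowr_ennpowr ennpowr_ennreal powr_powr mult.assoc)
    finally have "(ennreal (1 / x) * (\<integral>\<^sup>+t. ennreal \<bar>f t * g t\<bar> \<partial>lebesgue_on {0<..<x})) ennpowr p * ennreal (x powr \<alpha>)
      \<le> ennreal ((1 / x) powr p) * ?A x * (G ennpowr p * ennreal ((x powr \<delta> / \<delta>) powr (p - 1))) * ennreal (x powr \<alpha>)"
      by (rule mult_right_mono) simp
    also have "\<dots> = G ennpowr p * ?A x * ennreal ((1 / x) powr p * (x powr \<delta> / \<delta>) powr (p - 1) * x powr \<alpha>)"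
      by (simp add: ennreal_mult mult_ac)
    also have "(1 / x) powr p * (x powr \<delta> / \<delta>) powr (p - 1) * x powr \<alpha> = (1 / \<delta>) powr (p - 1) * x powr (- 1 - \<delta>)"
    proof -
      have e: "- p + \<delta> * (p - 1) + \<alpha> = -1 - \<delta>" using p by (simp add: \<delta>_def field_simps)
      have "(1 / x) powr p * (x powr \<delta> / \<delta>) powr (p - 1) * x powr \<alpha>
        = (1 / \<delta>) powr (p - 1) * x powr (- p + \<delta> * (p - 1) + \<alpha>)"
        unfolding powr_add using that by (simp add: powr_divide powr_powr powr_minus field_simps)
      then show ?thesis by (simp only: e)
    qed
    finally show ?thesis by (simp add: ennreal_mult mult_ac)
  qed
  then have "(\<integral>\<^sup>+x. (ennreal (1 / x) * (\<integral>\<^sup>+t. ennreal \<bar>f t * g t\<bar> \<partial>lebesgue_on {0<..<x})) ennpowr p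
        * ennreal (x powr \<alpha>) \<partial>ray)
      \<le> (\<integral>\<^sup>+x. ?C * (ennreal (x powr (-1 - \<delta>)) * ?A x) \<partial>ray)"
    by (intro nn_integral_mono) auto
  also have "\<dots> = ?C * (\<integral>\<^sup>+x. ennreal (x powr (-1 - \<delta>)) * ?A x \<partial>ray)"
    by (intro nn_integral_cmult borel_measurable_times_ennreal measurable_initial_integral) measurable
  also have "(\<integral>\<^sup>+x. ennreal (x powr (-1 - \<delta>)) * ?A x \<partial>ray)
    = (\<integral>\<^sup>+t. ennreal (\<bar>f t\<bar> powr p * t powr (\<alpha> + \<delta>)) * (\<integral>\<^sup>+x. ennreal (x powr (-1 - \<delta>)) \<partial>lebesgue_on {t<..}) \<partial>ray)"
    by (intro Tonelli_triangle) measurable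
  also have "\<dots> = (\<integral>\<^sup>+t. ennreal (1 / \<delta>) * ennreal (\<bar>f t\<bar> powr p * t powr \<alpha>) \<partial>ray)"
  proof (intro nn_integral_cong)
    fix t assume "t \<in> space ray"
    then have "0 < t" by simp
    then show "ennreal (\<bar>f t\<bar> powr p * t powr (\<alpha> + \<delta>)) * (\<integral>\<^sup>+x. ennreal (x powr (-1 - \<delta>)) \<partial>lebesgue_on {t<..})
      = ennreal (1 / \<delta>) * ennreal (\<bar>f t\<bar> powr p * t powr \<alpha>)"
      using pos by (subst nn_integral_powr_final)
        (auto simp: powr_add powr_minus field_simps simp flip: ennreal_mult)
  qed
  also have "\<dots> = ennreal (1 / \<delta>) * (\<integral>\<^sup>+t. ennreal (\<bar>f t\<bar> powr p * t powr \<alpha>) \<partial>ray)"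
    by (rule nn_integral_cmult) measurable
  also have "?C * \<dots> = ennreal ((1 / \<delta>) powr p) * (\<integral>\<^sup>+t. ennreal (\<bar>f t\<bar> powr p * t powr \<alpha>) \<partial>ray) * G ennpowr p"
  proof -
    have "(1 / \<delta>) powr p = (1 / \<delta>) powr (p - 1) * (1 / \<delta>)"
      using pos powr_add[of "1 / \<delta>" "p - 1" 1] by simp
    then have "ennreal ((1 / \<delta>) powr p) = ennreal ((1 / \<delta>) powr (p - 1)) * ennreal (1 / \<delta>)"
      using pos by (simp flip: ennreal_mult)
    then show ?thesis by (simp only: mult_ac)
  qed
  finally have "Ces_norm p \<alpha> (\<lambda>x. f x * g x) \<le> (ennreal ((1 / \<delta>) powr p)
      * (\<integral>\<^sup>+t. ennreal (\<bar>f t\<bar> powr p * t powr \<alpha>) \<partial>ray) * G ennpowr p) ennpowr (1 / p)"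
    unfolding Ces_norm_def using p by (intro ennpowr_mono) auto
  also have "\<dots> = ennreal (1 / \<delta>) * (Lp_norm p \<alpha> f * G)"
    using p pos by (simp add: ennpowr_mult ennpowr_ennpowr ennpowr_ennreal powr_powr Lp_norm_def mult.assoc)
  finally show ?thesis by (simp add: G_def \<delta>_def)
qed

lemma Ces_norm_cong_AE:
  assumes "AE x in ray. h x = k x"
  shows "Ces_norm p \<alpha> h = Ces_norm p \<alpha> k"
proof -
  have "AE t in lebesgue_on {0<..<x}. ennreal \<bar>h t\<bar> = ennreal \<bar>k t\<bar>" for x
    using AE_restrict_initial[OF assms] by (rule eventually_mono) simp
  then have "(\<integral>\<^sup>+t. ennreal \<bar>h t\<bar> \<partial>lebesgue_on {0<..<x}) = (\<integral>\<^sup>+t. ennreal \<bar>k t\<bar> \<partial>lebesgue_on {0<..<x})" for x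
    by (rule nn_integral_cong_AE)
  then show ?thesis by (simp add: Ces_norm_def)
qed

lemma Ces_norm_le_factorization:
  assumes p: "1 < p" and q: "q = p / (p - 1)" and \<alpha>: "\<alpha> < p - 1"
    and fg: "(f, g) \<in> factorizations p \<alpha> q (\<alpha> * (1 - q)) h"
  shows "Ces_norm p \<alpha> h \<le> ennreal (p / (p - \<alpha> - 1)) * (Lp_norm p \<alpha> f * G_norm q (\<alpha> * (1 - q)) g)"
  using Ces_norm_mult_le[OF p q \<alpha>, of f g] Ces_norm_cong_AE[of h "\<lambda>x. f x * g x" p \<alpha>] fg
  by (simp add: factorizations_def Lp_space_def G_space_def)

section \<open>Construction of the factorization\<close>

lemma Lp_norm_0 [simp]: "Lp_norm p \<alpha> (\<lambda>x. 0) = 0"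
  by (simp add: Lp_norm_def)

lemma G_norm_0 [simp]: "G_norm q \<beta> (\<lambda>x. 0) = 0"
  by (simp add: G_norm_def)

text \<open>
  The factorization attains the lower estimate: the norm of \<open>f\<close> is that of \<open>h\<close>, and the norm of \<open>g\<close> is
  bounded by a constant that depends on \<open>p\<close> and \<open>\<alpha>\<close> only. The exponents in \<open>f\<close> and \<open>g\<close> are forced by the
  requirements that the integrand of the norm of \<open>f\<close> be \<open>|h| \<Psi>\<close> and that the product be \<open>h\<close>.
\<close>

lemma Ces_factorization:
  assumes p: "1 < p" and q: "q = p / (p - 1)" and \<alpha>: "\<alpha> < p - 1"
    and h: "h \<in> Ces_space p \<alpha>"
  obtains f g where "f \<in> Lp_space p \<alpha>" "g \<in> G_space q (\<alpha> * (1 - q))"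
    "AE x in ray. h x = f x * g x"
    "Lp_norm p \<alpha> f \<le> Ces_norm p \<alpha> h"
    "G_norm q (\<alpha> * (1 - q)) g \<le> ennreal ((p - 1 - \<alpha>) * (p - 1) powr (- 1 / q))"
proof -
  define \<kappa> where "\<kappa> = p - 1 - \<alpha>"
  define \<beta> where "\<beta> = \<alpha> * (1 - q)"
  define I where "I = (\<lambda>x. \<integral>\<^sup>+s. ennreal \<bar>h s\<bar> \<partial>lebesgue_on {0<..<x})"
  define \<Psi> where "\<Psi> = (\<lambda>t. \<integral>\<^sup>+x. I x ennpowr (p - 1) * ennreal (x powr (- 1 - \<kappa>)) \<partial>lebesgue_on {t<..})"
  have hm [measurable]: "h \<in> borel_measurable ray"
    and fin: "Ces_norm p \<alpha> h < top"
    using h by (simp_all add: Ces_space_def meas_pos_def)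
  have \<kappa>: "0 < \<kappa>" using \<alpha> by (simp add: \<kappa>_def)
  have q1: "0 < q" "q / p = 1 / (p - 1)" using p by (auto simp: q)
  have \<beta>1: "\<beta> + 1 = \<kappa> / (p - 1)" using p by (simp add: \<beta>_def \<kappa>_def q field_simps)
  then have \<beta>_pos: "0 < \<beta> + 1" using \<kappa> p by simp
  have Im [measurable]: "I \<in> borel_measurable ray"
    unfolding I_def by (rule measurable_initial_integral) measurable
  have \<Psi>m [measurable]: "\<Psi> \<in> borel_measurable ray"
    unfolding \<Psi>_def by (rule measurable_final_integral) measurable
  \<comment> \<open>The factor \<open>1 / x\<close> of the averages is absorbed in the power, whose exponent
    becomes \<open>\<alpha> - p = -1 - \<kappa>\<close>.\<close>
  have Ces_I: "(\<integral>\<^sup>+x. I x ennpowr p * ennreal (x powr (- 1 - \<kappa>)) \<partial>ray) = Ces_norm p \<alpha> h ennpowr p"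
  proof -
    have "(ennreal (1 / x) * I x) ennpowr p * ennreal (x powr \<alpha>) = I x ennpowr p * ennreal (x powr (- 1 - \<kappa>))"
      if "0 < x" for x
    proof -
      have "(1 / x) powr p * x powr \<alpha> = x powr (- 1 - \<kappa>)"
        using that by (simp add: \<kappa>_def powr_divide powr_diff)
      then have "ennreal ((1 / x) powr p) * ennreal (x powr \<alpha>) = ennreal (x powr (- 1 - \<kappa>))"
        by (simp flip: ennreal_mult)
      moreover have "ennreal (1 / x) ennpowr p = ennreal ((1 / x) powr p)"
        using that by (simp add: ennpowr_ennreal)
      ultimately show ?thesis
        by (simp add: ennpowr_mult mult.commute[of _ "I x ennpowr p"] mult.assoc)
    qed
    then have "(\<integral>\<^sup>+x. I x ennpowr p * ennreal (x powr (- 1 - \<kappa>)) \<partial>ray)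
      = (\<integral>\<^sup>+x. (ennreal (1 / x) * I x) ennpowr p * ennreal (x powr \<alpha>) \<partial>ray)"
      by (intro nn_integral_cong) simp
    then show ?thesis using p by (simp add: Ces_norm_def I_def ennpowr_ennpowr)
  qed
  have tail_fin: "(\<integral>\<^sup>+x. I x ennpowr p * ennreal (x powr (- 1 - \<kappa>)) \<partial>lebesgue_on {t<..}) < top"
    if "0 < t" for t
  proof -
    have "(\<integral>\<^sup>+x. I x ennpowr p * ennreal (x powr (- 1 - \<kappa>)) \<partial>lebesgue_on {t<..})
      \<le> Ces_norm p \<alpha> h ennpowr p"
      unfolding Ces_I[symmetric] using that by (intro final_integral_antimono) simp
    then show ?thesis using fin by (simp add: le_less_trans)
  qed
  have I_fin: "I t < top" if "0 < t" for t
  proof (rule ccontr)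
    assume "\<not> I t < top"
    then have "I t = top" by (simp flip: less_top)
    then have "I t ennpowr p * ennreal (t powr (- \<kappa>) / \<kappa>) = top"
      using that \<kappa> by (simp add: ennreal_top_mult ennreal_eq_0_iff not_le)
    then show False
      using initial_integral_tail_bound[of p \<kappa> t "\<lambda>s. ennreal \<bar>h s\<bar>"] tail_fin[OF that] p \<kappa> that
      by (simp add: I_def top_unique)
  qed
  have \<Psi>_fin: "\<Psi> t < top" if "0 < t" for t
  proof -
    have m: "(\<lambda>x. ennreal (x powr (- 1 - \<kappa>))) \<in> borel_measurable (lebesgue_on {t<..})"
      "(\<lambda>x. I x ennpowr p * ennreal (x powr (- 1 - \<kappa>))) \<in> borel_measurable (lebesgue_on {t<..})"
      using that by (simp_all add: measurable_restrict_final)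
    have "\<Psi> t \<le> (\<integral>\<^sup>+x. ennreal (x powr (- 1 - \<kappa>)) + I x ennpowr p * ennreal (x powr (- 1 - \<kappa>)) \<partial>lebesgue_on {t<..})"
      unfolding \<Psi>_def
    proof (intro nn_integral_mono)
      fix x
      have "I x ennpowr (p - 1) \<le> 1 + I x ennpowr p"
        using p by (intro ennpowr_powr_le_1_plus) auto
      from mult_right_mono[OF this, of "ennreal (x powr (- 1 - \<kappa>))"]
      show "I x ennpowr (p - 1) * ennreal (x powr (- 1 - \<kappa>))
        \<le> ennreal (x powr (- 1 - \<kappa>)) + I x ennpowr p * ennreal (x powr (- 1 - \<kappa>))"
        by (simp add: distrib_right)
    qed
    also have "\<dots> = ennreal (t powr (- \<kappa>) / \<kappa>)
        + (\<integral>\<^sup>+x. I x ennpowr p * ennreal (x powr (- 1 - \<kappa>)) \<partial>lebesgue_on {t<..})"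
      by (subst nn_integral_add[OF m]) (simp add: nn_integral_powr_final[OF \<kappa> that])
    also have "\<dots> < top" using tail_fin[OF that] by simp
    finally show ?thesis .
  qed
  have \<Psi>_lower: "I t ennpowr (p - 1) * ennreal (t powr (- \<kappa>) / \<kappa>) \<le> \<Psi> t" if "0 < t" for t
    using initial_integral_tail_bound[of "p - 1" \<kappa> t "\<lambda>s. ennreal \<bar>h s\<bar>"] p \<kappa> that
    by (simp add: I_def \<Psi>_def)
  have \<Psi>_antimono: "\<Psi> s \<le> \<Psi> t" if "t \<le> s" for s t
    unfolding \<Psi>_def using that by (rule final_integral_antimono)
  show thesis
  proof (cases "\<exists>t>0. \<Psi> t = 0")
    case True
    then obtain t where t: "0 < t" "\<Psi> t = 0" by blast
    \<comment> \<open>Here \<open>h\<close> vanishes almost everywhere, and the general formulas would divide by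
      \<open>\<Psi> t = 0\<close>.\<close>
    have "I x = 0" if "t \<le> x" for x
    proof -
      have "0 < x" using t that by simp
      then have "I x ennpowr (p - 1) * ennreal (x powr (- \<kappa>) / \<kappa>) = 0"
        using \<Psi>_lower[of x] \<Psi>_antimono[OF that] t by simp
      moreover have "0 < x powr (- \<kappa>) / \<kappa>" using \<open>0 < x\<close> \<kappa> by simp
      ultimately show ?thesis by (simp add: ennreal_eq_0_iff not_le)
    qed
    then have "AE x in ray. h x = 0"
      unfolding I_def by (rule AE_ray_eq_0I[OF hm, of t])
    then show thesis
      using that[of "\<lambda>x. 0" "\<lambda>x. 0"]
      by (simp add: Lp_space_def G_space_def meas_pos_def)
  next
    case False
    define \<psi> where "\<psi> = (\<lambda>t. enn2real (\<Psi> t))"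
    have \<psi>m [measurable]: "\<psi> \<in> borel_measurable ray" unfolding \<psi>_def by simp
    have \<Psi>_eq: "\<Psi> t = ennreal (\<psi> t)" if "0 < t" for t
      using \<Psi>_fin[OF that] by (simp add: \<psi>_def)
    have \<psi>_pos: "0 < \<psi> t" if "0 < t" for t
      using False that \<Psi>_fin[OF that] by (auto simp: \<psi>_def enn2real_positive_iff zero_less_iff_neq_zero)
    have \<psi>_antimono: "\<psi> s \<le> \<psi> t" if "0 < t" "t \<le> s" for s t
      using \<Psi>_antimono[OF that(2)] \<Psi>_fin[OF that(1)] by (simp add: \<psi>_def enn2real_mono)
    define f where "f = (\<lambda>x. \<bar>h x\<bar> powr (1 / p) * \<psi> x powr (1 / p) * x powr (- \<alpha> / p))"
    define g where "g = (\<lambda>x. sgn (h x) * \<bar>h x\<bar> powr (1 / q) * \<psi> x powr (- 1 / p) * x powr (- \<beta> / q))"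
    have fm: "f \<in> meas_pos" and gm: "g \<in> meas_pos"
      by (simp_all add: f_def g_def meas_pos_def)
    have fg: "h x = f x * g x" if "0 < x" for x
    proof -
      have "f x * g x = sgn (h x) * (\<bar>h x\<bar> powr (1 / p) * \<bar>h x\<bar> powr (1 / q))
          * (\<psi> x powr (1 / p) * \<psi> x powr (- 1 / p)) * (x powr (- \<alpha> / p) * x powr (- \<beta> / q))"
        by (simp add: f_def g_def)
      also have "\<bar>h x\<bar> powr (1 / p) * \<bar>h x\<bar> powr (1 / q) = \<bar>h x\<bar>"
        using p by (simp add: q field_simps flip: powr_add)
      also have "\<psi> x powr (1 / p) * \<psi> x powr (- 1 / p) = 1"
        using \<psi>_pos[OF that] by (simp flip: powr_add)
      also have "x powr (- \<alpha> / p) * x powr (- \<beta> / q) = 1"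
      proof -
        have "- \<alpha> / p + - \<beta> / q = 0" using p by (simp add: \<beta>_def q field_simps)
        then show ?thesis using that by (simp flip: powr_add)
      qed
      finally show ?thesis by (simp add: sgn_mult_abs)
    qed
    have f_int: "\<bar>f x\<bar> powr p * x powr \<alpha> = \<bar>h x\<bar> * \<psi> x" if "0 < x" for x
      using p that \<psi>_pos[OF that]
      by (simp add: f_def powr_mult powr_powr abs_mult powr_minus inverse_powr)
    have g_int: "\<bar>g x\<bar> powr q * x powr \<beta> = \<bar>h x\<bar> * \<psi> x powr (- 1 / (p - 1))" if "0 < x" for x
      using q1 that \<psi>_pos[OF that]
      by (simp add: g_def powr_mult powr_powr abs_mult powr_minus inverse_powr abs_sgn_eq)
    have "(\<integral>\<^sup>+x. ennreal (\<bar>f x\<bar> powr p * x powr \<alpha>) \<partial>ray) = (\<integral>\<^sup>+x. ennreal \<bar>h x\<bar> * \<Psi> x \<partial>ray)"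
    proof (intro nn_integral_cong)
      fix x assume "x \<in> space ray"
      then have "0 < x" by simp
      then show "ennreal (\<bar>f x\<bar> powr p * x powr \<alpha>) = ennreal \<bar>h x\<bar> * \<Psi> x"
        using \<psi>_pos[of x] by (simp add: f_int \<Psi>_eq ennreal_mult)
    qed
    \<comment> \<open>One factor \<open>I x\<close> is recovered from \<open>|h|\<close> by exchanging the integrals, which raises
      the exponent from \<open>p - 1\<close> to \<open>p\<close>.\<close>
    also have "\<dots> = (\<integral>\<^sup>+x. I x ennpowr (p - 1) * ennreal (x powr (- 1 - \<kappa>)) * I x \<partial>ray)"
    proof -
      have "(\<integral>\<^sup>+x. I x ennpowr (p - 1) * ennreal (x powr (- 1 - \<kappa>))
            * (\<integral>\<^sup>+s. ennreal \<bar>h s\<bar> \<partial>lebesgue_on {0<..<x}) \<partial>ray)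
        = (\<integral>\<^sup>+x. ennreal \<bar>h x\<bar> * \<Psi> x \<partial>ray)"
        unfolding \<Psi>_def by (rule Tonelli_triangle) measurable
      moreover have "(\<integral>\<^sup>+s. ennreal \<bar>h s\<bar> \<partial>lebesgue_on {0<..<x}) = I x" for x
        by (simp add: I_def)
      ultimately show ?thesis by simp
    qed
    also have "\<dots> = Ces_norm p \<alpha> h ennpowr p"
    proof -
      have "I x ennpowr p = I x ennpowr (p - 1) * I x" for x
        using ennpowr_add[of "p - 1" 1 "I x"] p by simp
      then show ?thesis by (simp add: mult_ac flip: Ces_I)
    qed
    finally have f_norm: "Lp_norm p \<alpha> f = Ces_norm p \<alpha> h"
      using p by (simp add: Lp_norm_def ennpowr_ennpowr)
    have g_norm: "G_norm q \<beta> g \<le> ennreal (\<kappa> * (p - 1) powr (- 1 / q))"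
      unfolding G_norm_def
    proof (intro SUP_least)
      fix t :: real assume "t \<in> {0<..}"
      then have t: "0 < t" by simp
      let ?D = "t powr (\<beta> + 1) / (\<beta> + 1)"
      have D: "(\<integral>\<^sup>+x. ennreal (x powr \<beta>) \<partial>lebesgue_on {0<..<t}) = ennreal ?D"
        using \<beta>_pos t by (intro nn_integral_powr_initial) auto
      have "(\<integral>\<^sup>+x. ennreal (\<bar>g x\<bar> powr q * x powr \<beta>) \<partial>lebesgue_on {0<..<t})
        \<le> (\<integral>\<^sup>+x. ennreal (\<psi> t powr (- 1 / (p - 1))) * ennreal \<bar>h x\<bar> \<partial>lebesgue_on {0<..<t})"
      proof (intro nn_integral_mono)
        fix x assume "x \<in> space (lebesgue_on {0<..<t})"
        then have x: "0 < x" "x < t" by auto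
        have "\<psi> x powr (- 1 / (p - 1)) \<le> \<psi> t powr (- 1 / (p - 1))"
          using \<psi>_pos[of t] \<psi>_antimono[of x t] x p by (intro powr_mono2') auto
        then have "\<bar>g x\<bar> powr q * x powr \<beta> \<le> \<psi> t powr (- 1 / (p - 1)) * \<bar>h x\<bar>"
          unfolding g_int[OF x(1)] by (subst mult.commute) (intro mult_right_mono, auto)
        then show "ennreal (\<bar>g x\<bar> powr q * x powr \<beta>)
            \<le> ennreal (\<psi> t powr (- 1 / (p - 1))) * ennreal \<bar>h x\<bar>"
          by (simp add: ennreal_leI flip: ennreal_mult)
      qed
      also have "\<dots> = ennreal (\<psi> t powr (- 1 / (p - 1))) * I t"
        unfolding I_def by (intro nn_integral_cmult measurable_restrict_initial) measurable
      \<comment> \<open>The bound of \<open>\<Psi>\<close> from below is solved for \<open>I t\<close>, so that \<open>\<psi> t\<close> cancels.\<close>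
      also have "\<dots> \<le> ennreal (\<kappa> powr (1 / (p - 1)) * t powr (\<beta> + 1))"
      proof -
        obtain i where i: "I t = ennreal i" "0 \<le> i"
          using I_fin[OF t] by (cases "I t") auto
        have "i powr (p - 1) * (t powr (- \<kappa>) / \<kappa>) \<le> \<psi> t"
          using \<Psi>_lower[OF t] \<psi>_pos[OF t] \<kappa>
          by (simp add: i \<Psi>_eq[OF t] ennpowr_ennreal flip: ennreal_mult)
        then have "i powr (p - 1) \<le> \<kappa> * t powr \<kappa> * \<psi> t"
          using t \<kappa> by (simp add: powr_minus field_simps)
        then have "(i powr (p - 1)) powr (1 / (p - 1)) \<le> (\<kappa> * t powr \<kappa> * \<psi> t) powr (1 / (p - 1))"
          using p by (intro powr_mono2) auto
        then have "i \<le> \<kappa> powr (1 / (p - 1)) * t powr (\<beta> + 1) * \<psi> t powr (1 / (p - 1))"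
          using p i(2) by (simp add: powr_powr powr_mult \<beta>1)
        then have "\<psi> t powr (- 1 / (p - 1)) * i \<le> \<kappa> powr (1 / (p - 1)) * t powr (\<beta> + 1)"
          using \<psi>_pos[OF t] by (simp add: powr_minus field_simps)
        then show ?thesis using i by (simp add: ennreal_leI flip: ennreal_mult)
      qed
      finally have N: "(\<integral>\<^sup>+x. ennreal (\<bar>g x\<bar> powr q * x powr \<beta>) \<partial>lebesgue_on {0<..<t})
        \<le> ennreal (\<kappa> powr (1 / (p - 1)) * t powr (\<beta> + 1))" .
      have c: "(\<kappa> * (p - 1) powr (- 1 / q)) powr q * ?D = \<kappa> powr (1 / (p - 1)) * t powr (\<beta> + 1)"
      proof -
        have "q = 1 + 1 / (p - 1)" using p by (simp add: q field_simps)
        then have "\<kappa> powr q = \<kappa> * \<kappa> powr (1 / (p - 1))" using \<kappa> by (simp add: powr_add)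
        moreover have "(\<kappa> * (p - 1) powr (- 1 / q)) powr q = \<kappa> powr q * (p - 1) powr (- 1)"
          using q1 by (simp add: powr_mult powr_powr)
        moreover have "(p - 1) powr (- 1) = 1 / (p - 1)" using p by simp
        ultimately show ?thesis using p \<kappa> by (simp add: \<beta>1)
      qed
      have "(\<integral>\<^sup>+x. ennreal (\<bar>g x\<bar> powr q * x powr \<beta>) \<partial>lebesgue_on {0<..<t}) / ennreal ?D
        \<le> ennreal (\<kappa> * (p - 1) powr (- 1 / q)) ennpowr q"
      proof (rule divide_le_posI_ennreal)
        show "0 < ennreal ?D" using t \<beta>_pos by simp
        have "ennreal ?D * ennreal (\<kappa> * (p - 1) powr (- 1 / q)) ennpowr q
          = ennreal ((\<kappa> * (p - 1) powr (- 1 / q)) powr q * ?D)"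
          using t \<beta>_pos \<kappa> by (simp add: ennpowr_ennreal mult.commute flip: ennreal_mult)
        then show "(\<integral>\<^sup>+x. ennreal (\<bar>g x\<bar> powr q * x powr \<beta>) \<partial>lebesgue_on {0<..<t})
          \<le> ennreal ?D * ennreal (\<kappa> * (p - 1) powr (- 1 / q)) ennpowr q"
          using N by (simp only: c)
      qed
      then show "((\<integral>\<^sup>+x. ennreal (\<bar>g x\<bar> powr q * x powr \<beta>) \<partial>lebesgue_on {0<..<t})
          / (\<integral>\<^sup>+x. ennreal (x powr \<beta>) \<partial>lebesgue_on {0<..<t})) ennpowr (1 / q)
        \<le> ennreal (\<kappa> * (p - 1) powr (- 1 / q))"
        unfolding D using q1 by (subst ennpowr_le_iff) auto
    qed
    show thesis
    proof (rule that[of f g])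
      show "f \<in> Lp_space p \<alpha>" using fm f_norm fin by (simp add: Lp_space_def)
      show "g \<in> G_space q (\<alpha> * (1 - q))"
        using gm g_norm by (auto simp: G_space_def \<beta>_def le_less_trans)
      show "AE x in ray. h x = f x * g x"
        using fg by (intro AE_I2) simp
      show "Lp_norm p \<alpha> f \<le> Ces_norm p \<alpha> h" by (simp add: f_norm)
      show "G_norm q (\<alpha> * (1 - q)) g \<le> ennreal ((p - 1 - \<alpha>) * (p - 1) powr (- 1 / q))"
        using g_norm by (simp add: \<beta>_def \<kappa>_def)
    qed
  qed
qed

lemma lower_constant_eq:
  fixes p q \<alpha> :: real
  assumes p: "1 < p" and q: "q = p / (p - 1)" and \<alpha>: "\<alpha> < p - 1"
  shows "(1 / p) powr (1 / p) * (1 / q) powr (1 / q) * (p / (p - \<alpha> - 1))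
    * ((p - 1 - \<alpha>) * (p - 1) powr (- 1 / q)) = 1" (is "?L * ?K = 1")
proof -
  have "?L * ?K = (1 / p) powr (1 / p) * ((1 / q) powr (1 / q) * (p - 1) powr (- 1 / q))
      * (p / (p - \<alpha> - 1) * (p - 1 - \<alpha>))"
    by (simp only: mult_ac)
  also have "\<dots> = p powr (- 1 / p) * p powr (- 1 / q) * p powr 1"
  proof (intro arg_cong2[where f = "(*)"])
    show "(1 / p) powr (1 / p) = p powr (- 1 / p)"
      using p by (simp add: powr_minus divide_inverse inverse_powr)
    show "(1 / q) powr (1 / q) * (p - 1) powr (- 1 / q) = p powr (- 1 / q)"
      using p by (simp add: q powr_divide powr_minus divide_inverse powr_mult inverse_powr)
    show "p / (p - \<alpha> - 1) * (p - 1 - \<alpha>) = p powr 1"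
      using p \<alpha> by (simp add: field_simps)
  qed
  also have "\<dots> = p powr (- 1 / p + - 1 / q + 1)"
    by (simp only: powr_add)
  also have "\<dots> = 1"
  proof -
    have "- 1 / p + - 1 / q + 1 = 0" using p by (simp add: q divide_simps)
    then show ?thesis using p by simp
  qed
  finally show ?thesis .
qed

section \<open>The factorization theorem for Cesaro spaces\<close>

theorem corollary3p2:
  fixes p p' \<alpha> :: real and h :: "real \<Rightarrow> real"
  assumes "p > 1" and "p' = p / (p - 1)" and "-1 < \<alpha>" and "\<alpha> < p - 1"
    and "h \<in> meas_pos"
  shows "(h \<in> Ces_space p \<alpha> \<longleftrightarrow>
            (\<exists>f \<in> Lp_space p \<alpha>. \<exists>g \<in> G_space p' (\<alpha> * (1 - p')).
               AE x in lebesgue_on {0<..}. h x = f x * g x)) \<and>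
         (h \<in> Ces_space p \<alpha> \<longrightarrow>
            ennreal ((1 / p) powr (1 / p) * (1 / p') powr (1 / p') * (p / (p - \<alpha> - 1)))
                * factorization_norm p \<alpha> p' (\<alpha> * (1 - p')) h
              \<le> Ces_norm p \<alpha> h \<and>
            Ces_norm p \<alpha> h
              \<le> ennreal (p / (p - \<alpha> - 1)) * factorization_norm p \<alpha> p' (\<alpha> * (1 - p')) h)"
proof (intro conjI impI iffI)
  note range = assms(1,2,4)
  let ?\<beta> = "\<alpha> * (1 - p')"
  let ?C = "p / (p - \<alpha> - 1)"
  have C: "0 < ?C" using range by simp
  show "\<exists>f \<in> Lp_space p \<alpha>. \<exists>g \<in> G_space p' ?\<beta>. AE x in ray. h x = f x * g x"
    if "h \<in> Ces_space p \<alpha>"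
    using Ces_factorization[OF range that] by blast
  show "h \<in> Ces_space p \<alpha>"
    if "\<exists>f \<in> Lp_space p \<alpha>. \<exists>g \<in> G_space p' ?\<beta>. AE x in ray. h x = f x * g x"
  proof -
    from that obtain f g where fg: "(f, g) \<in> factorizations p \<alpha> p' ?\<beta> h"
      by (auto simp: factorizations_def)
    then have "ennreal ?C * (Lp_norm p \<alpha> f * G_norm p' ?\<beta> g) < top"
      by (auto simp: factorizations_def Lp_space_def G_space_def ennreal_mult_less_top)
    then show ?thesis
      using le_less_trans[OF Ces_norm_le_factorization[OF range fg]] assms(5)
      by (simp add: Ces_space_def)
  qed
  show "Ces_norm p \<alpha> h \<le> ennreal ?C * factorization_norm p \<alpha> p' ?\<beta> h"
  proof -
    have "Ces_norm p \<alpha> h / ennreal ?C \<le> factorization_norm p \<alpha> p' ?\<beta> h"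
      unfolding factorization_norm_def
    proof (intro INF_greatest, clarify)
      fix f g assume "(f, g) \<in> factorizations p \<alpha> p' ?\<beta> h"
      then show "Ces_norm p \<alpha> h / ennreal ?C \<le> Lp_norm p \<alpha> f * G_norm p' ?\<beta> g"
        using Ces_norm_le_factorization[OF range, of f g h] C
        by (intro divide_le_posI_ennreal) (auto simp: mult_ac)
    qed
    from ennreal_le_mult_of_divide_le[OF this] C show ?thesis
      by (simp add: mult.commute ennreal_eq_0_iff not_le)
  qed
  show "ennreal ((1 / p) powr (1 / p) * (1 / p') powr (1 / p') * ?C) * factorization_norm p \<alpha> p' ?\<beta> h
      \<le> Ces_norm p \<alpha> h"
    if h_Ces: "h \<in> Ces_space p \<alpha>"
  proof -
    let ?L = "(1 / p) powr (1 / p) * (1 / p') powr (1 / p') * ?C"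
    let ?K = "(p - 1 - \<alpha>) * (p - 1) powr (- 1 / p')"
    obtain f g where fg: "(f, g) \<in> factorizations p \<alpha> p' ?\<beta> h"
      and le: "Lp_norm p \<alpha> f \<le> Ces_norm p \<alpha> h" "G_norm p' ?\<beta> g \<le> ennreal ?K"
    proof (rule Ces_factorization[OF range h_Ces])
      fix f g
      assume "f \<in> Lp_space p \<alpha>" "g \<in> G_space p' ?\<beta>" "AE x in ray. h x = f x * g x"
        and *: "Lp_norm p \<alpha> f \<le> Ces_norm p \<alpha> h" "G_norm p' ?\<beta> g \<le> ennreal ?K"
      then have "(f, g) \<in> factorizations p \<alpha> p' ?\<beta> h" by (simp add: factorizations_def)
      from that[OF this *] show thesis .
    qed
    have LK: "?L * ?K = 1"
      by (rule lower_constant_eq[OF range])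
    have "ennreal ?L * factorization_norm p \<alpha> p' ?\<beta> h \<le> ennreal ?L * (Lp_norm p \<alpha> f * G_norm p' ?\<beta> g)"
      unfolding factorization_norm_def by (rule mult_left_mono, rule INF_lower2[OF fg]) simp_all
    also have "\<dots> \<le> ennreal ?L * (Ces_norm p \<alpha> h * ennreal ?K)"
      by (rule mult_left_mono[OF mult_mono[OF le]]) simp_all
    also have "\<dots> = ennreal (?L * ?K) * Ces_norm p \<alpha> h"
    proof -
      have "ennreal (?L * ?K) = ennreal ?L * ennreal ?K"
        using range by (intro ennreal_mult mult_nonneg_nonneg powr_ge_zero) simp_all
      then show ?thesis by (simp only: mult_ac)
    qed
    also have "\<dots> = Ces_norm p \<alpha> h" by (simp only: LK ennreal_1 mult_1)
    finally show ?thesis .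
  qed
qed

end
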